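(* Let $n\ge1$ be an integer, let $a<b$ be real numbers, let $P_0,\dots,P_{n-1}$ be continuous functions on $[a,b]$, and let $c_0,\dots,c_{n-1}$ be constants. The solution on $[a,b]$ of the homogeneous linear differential equation $$\Big(\partial_x^n+\sum_{k=0}^{n-1}P_k(x)\,\partial_x^k\Big)u(x)=0$$ with initial condition $\partial_x^iu(a)=c_i$ for $i=0,1,\dots,n-1$ is given by $$u(x)=D(x)+\int_a^x dz\,T(x,z)\,S(z),$$ where $$D(x)=\sum_{k=0}^{n-1}\frac{c_k(x-a)^k}{k!},\qquad S(x)=-\sum_{i=0}^{n-1}\sum_{k=0}^{i}c_i\,\frac{P_k(x)(x-a)^{i-k}}{(i-k)!},$$ and $T(x,y)$ is the function defined from $P_0,\dots,P_{n-1}$ in the context by a series of integrals.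
   Context: Functions and constants are complex-valued; integrals are oriented ($\int_y^x=-\int_x^y$). For $x,y\in[a,b]$ define $$h(x,y)=-\sum_{k=0}^{n-1}P_k(x)\,\frac{(x-y)^{n-k-1}}{(n-k-1)!},$$ $$R(x,y)=h(x,y)+\sum_{r=2}^{\infty}\int_y^x dz_1\int_y^{z_1}dz_2\cdots\int_y^{z_{r-2}}dz_{r-1}\,h(x,z_1)\,h(z_1,z_2)\cdots h(z_{r-1},y)$$ (for $r=2$ the term is $\int_y^x dz_1\,h(x,z_1)h(z_1,y)$), and $$T(x,y)=\frac{(x-y)^{n-1}}{(n-1)!}+\int_y^x dz\,\frac{(x-z)^{n-1}}{(n-1)!}\,R(z,y).$$ *)

theory Defs
  imports "HOL-Analysis.Analysis"
begin

text \<open>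
  Throughout, \<open>P k\<close> (\<open>k < n\<close>) are the coefficient functions; only their values on the interval
  \<open>{a..b}\<close> matter. The integral \<open>LBINT z=y..x. f z\<close> is the oriented Lebesgue integral.
\<close>

definition h_ker :: "nat \<Rightarrow> (nat \<Rightarrow> real \<Rightarrow> complex) \<Rightarrow> real \<Rightarrow> real \<Rightarrow> complex" where
  "h_ker n P x y =
     - (\<Sum>k<n. P k x * (of_real (x - y) ^ (n - k - 1) / fact (n - k - 1)))"

text \<open>
  \<open>nested_int n P y m p x\<close> is the \<open>m\<close>-fold nested integral
  \[ \int_y^x dz_1 \int_y^{z_1} dz_2 \cdots \int_y^{z_{m-1}} dz_m \;
       p \, h(x,z_1) \, h(z_1,z_2) \cdots h(z_m,y), \]
  where the accumulator \<open>p\<close> carries the factors contributed by the enclosing integration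
  variables, so that the whole product stands under the innermost integral.
\<close>

primrec nested_int ::
    "nat \<Rightarrow> (nat \<Rightarrow> real \<Rightarrow> complex) \<Rightarrow> real \<Rightarrow> nat \<Rightarrow> complex \<Rightarrow> real \<Rightarrow> complex" where
  "nested_int n P y 0 p x = p * h_ker n P x y"
| "nested_int n P y (Suc m) p x =
     (LBINT z=y..x. nested_int n P y m (p * h_ker n P x z) z)"

text \<open>The term of index \<open>r\<close> in the series is an \<open>(r - 1)\<close>-fold integral; below, \<open>r = j + 2\<close>.\<close>

definition R_term :: "nat \<Rightarrow> (nat \<Rightarrow> real \<Rightarrow> complex) \<Rightarrow> nat \<Rightarrow> real \<Rightarrow> real \<Rightarrow> complex" where
  "R_term n P r x y = nested_int n P y (r - 1) 1 x"

definition R_ker :: "nat \<Rightarrow> (nat \<Rightarrow> real \<Rightarrow> complex) \<Rightarrow> real \<Rightarrow> real \<Rightarrow> complex" where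
  "R_ker n P x y = h_ker n P x y + (\<Sum>j. R_term n P (j + 2) x y)"

definition T_ker :: "nat \<Rightarrow> (nat \<Rightarrow> real \<Rightarrow> complex) \<Rightarrow> real \<Rightarrow> real \<Rightarrow> complex" where
  "T_ker n P x y =
     of_real (x - y) ^ (n - 1) / fact (n - 1)
     + (LBINT z=y..x. of_real (x - z) ^ (n - 1) / fact (n - 1) * R_ker n P z y)"

definition D_fun :: "nat \<Rightarrow> real \<Rightarrow> (nat \<Rightarrow> complex) \<Rightarrow> real \<Rightarrow> complex" where
  "D_fun n a c x = (\<Sum>k<n. c k * of_real (x - a) ^ k / fact k)"

definition S_fun ::
    "nat \<Rightarrow> (nat \<Rightarrow> real \<Rightarrow> complex) \<Rightarrow> real \<Rightarrow> (nat \<Rightarrow> complex) \<Rightarrow> real \<Rightarrow> complex" where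
  "S_fun n P a c x =
     - (\<Sum>i<n. \<Sum>k\<le>i. c i * (P k x * of_real (x - a) ^ (i - k) / fact (i - k)))"

text \<open>Iterated derivative relative to \<open>{a..b}\<close> (one-sided at the endpoints).\<close>

definition deriv_on ::
    "real \<Rightarrow> real \<Rightarrow> nat \<Rightarrow> (real \<Rightarrow> complex) \<Rightarrow> real \<Rightarrow> complex" where
  "deriv_on a b i u =
     ((\<lambda>f x. vector_derivative f (at x within {a..b})) ^^ i) u"

text \<open>
  Differentiability is required explicitly, since \<open>vector_derivative\<close> is a total function
  with an arbitrary value where no derivative exists.
\<close>

definition solves_ivp ::
    "nat \<Rightarrow> real \<Rightarrow> real \<Rightarrow> (nat \<Rightarrow> real \<Rightarrow> complex) \<Rightarrow> (nat \<Rightarrow> complex) \<Rightarrow> (real \<Rightarrow> complex) \<Rightarrow> bool"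
  where
  "solves_ivp n a b P c u \<longleftrightarrow>
     (\<forall>i<n. deriv_on a b i u differentiable_on {a..b}) \<and>
     (\<forall>x\<in>{a..b}. deriv_on a b n u x + (\<Sum>k<n. P k x * deriv_on a b k u x) = 0) \<and>
     (\<forall>i<n. deriv_on a b i u a = c i)"

end

theory Submission
  imports Defs
begin

text \<open>
  Take the highest derivative \<open>w\<close> of \<open>u\<close> as the unknown. By Taylor's formula with integral remainder,
  \<open>u\<close> and its derivatives of order below \<open>n\<close> are determined by \<open>w\<close> and the initial values:
  \<open>u\<close> is \<open>D\<close> plus the integral over \<open>{a..x}\<close> of \<open>K x z * w z\<close>, where
  \<open>K x z = (x - z)^(n - 1) / (n - 1)!\<close>, and the derivatives have the corresponding form
  (\<open>Taylor_interval_integral\<close>). Substituted into the differential equation, this gives the Volterra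
  integral equation of the second kind \<open>w = S + h w\<close>, where a kernel also denotes its integral
  operator (\<open>lower_order_terms_eq\<close>).

  For a continuous kernel the Neumann series \<open>R = h + h h + h h h + \<dots>\<close> converges uniformly, since its
  terms are dominated by those of an exponential series (\<open>norm_iterated_kernel_le\<close>). The sum satisfies
  \<open>R = h + h R\<close> (\<open>resolvent_equation\<close>), whence \<open>w = S + R S\<close> is a solution of the Volterra equation;
  the same estimate shows that it is the only continuous one (\<open>volterra_equation_iff\<close>). Finally,
  \<open>u = D + K w = D + (K + K R) S = D + T S\<close>, where the exchange of two integrations over a triangle
  (\<open>interval_integral_swap_triangle\<close>) justifies the regrouping.

  Conversely, a function of this form is the \<open>n\<close>-fold repeated integral of \<open>w\<close> with the prescribed
  initial values (\<open>derivative_tower_exists\<close>), so that its derivatives are known and the differential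
  equation is again the Volterra equation for \<open>w\<close>.

  All kernels are continuous on the square \<open>{a..b} \<times> {a..b}\<close>, on both sides of the diagonal, and
  so all the integrals exist for either order of their endpoints.
\<close>

section \<open>Oriented integrals of continuous functions\<close>

text \<open>
  Writing an oriented integral over the fixed interval \<open>{0..1}\<close> removes the case distinction on the
  order of its endpoints and turns varying endpoints into parameters of the integrand. Estimates,
  continuity in the endpoints and passage to the limit are all obtained in this form.
\<close>

lemma interval_integral_rescale:
  fixes a b x y :: real and f :: "real \<Rightarrow> complex"
  assumes "continuous_on {a..b} f" "x \<in> {a..b}" "y \<in> {a..b}"
  shows "(LBINT z=y..x. f z) = (x - y) *\<^sub>R integral {0..1} (\<lambda>t. f (y + t * (x - y)))"
proof -
  have seg: "y + t * (x - y) \<in> {a..b}" if "t \<in> {0..1}" for t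
    using convexD_alt[of "{a..b}" y x t] assms that by (auto simp: algebra_simps)
  have cf: "continuous_on {0..1} (\<lambda>t. f (y + t * (x - y)))"
    by (rule continuous_on_compose2[OF assms(1)]) (use seg in \<open>auto intro!: continuous_intros\<close>)
  have "(LBINT t=0..1. (x - y) *\<^sub>R f (y + t * (x - y)))
      = (LBINT z=y + 0 * (x - y)..y + 1 * (x - y). f z)"
    using interval_integral_substitution_finite[of 0 1 "\<lambda>t. y + t * (x - y)" "\<lambda>_. x - y" f]
      continuous_on_subset[OF assms(1), of "(\<lambda>t. y + t * (x - y)) ` {0..1}"] seg
    by (force intro!: derivative_eq_intros simp: zero_ereal_def one_ereal_def)
  moreover have "(LBINT t=0..1. (x - y) *\<^sub>R f (y + t * (x - y)))
      = integral {0..1} (\<lambda>t. (x - y) *\<^sub>R f (y + t * (x - y)))"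
    unfolding zero_ereal_def one_ereal_def
    by (rule interval_integral_eq_integral) (auto intro!: borel_integrable_atLeastAtMost' continuous_intros cf)
  ultimately show ?thesis by simp
qed

lemma interval_integrable_continuous_unordered:
  fixes a b x y :: real and f :: "real \<Rightarrow> complex"
  assumes "continuous_on {a..b} f" "x \<in> {a..b}" "y \<in> {a..b}"
  shows "interval_lebesgue_integrable lborel y x f"
proof (cases "y \<le> x")
  case True
  then show ?thesis
    using assms by (intro interval_integrable_continuous_on continuous_on_subset[OF assms(1)]) auto
next
  case False
  then have "interval_lebesgue_integrable lborel x y f"
    using assms by (intro interval_integrable_continuous_on continuous_on_subset[OF assms(1)]) auto
  then show ?thesis by (simp add: interval_integrable_endpoints_reverse)
qed

lemma interval_integral_cong_Icc:
  fixes a b x y :: real and f g :: "real \<Rightarrow> complex"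
  assumes "x \<in> {a..b}" "y \<in> {a..b}" "\<And>z. z \<in> {a..b} \<Longrightarrow> f z = g z"
  shows "(LBINT z=y..x. f z) = (LBINT z=y..x. g z)"
  using assms by (intro interval_integral_cong)
    (auto simp: einterval_iff min_def max_def split: if_splits)

text \<open>
  After rescaling, the endpoints occur only in the integrand, so that the theorem on integrals
  depending continuously on a parameter applies.
\<close>

lemma continuous_on_interval_integral_param:
  fixes a b :: real and G :: "real \<Rightarrow> real \<Rightarrow> real \<Rightarrow> complex"
  assumes G: "continuous_on ({a..b} \<times> {a..b} \<times> {a..b}) (\<lambda>(x, z, y). G x z y)"
  shows "continuous_on ({a..b} \<times> {a..b}) (\<lambda>(x, y). LBINT z=y..x. G x z y)"
proof -
  have seg: "y + t * (x - y) \<in> {a..b}" if "t \<in> {0..1}" "x \<in> {a..b}" "y \<in> {a..b}" for t x y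
    using convexD_alt[of "{a..b}" y x t] that by (auto simp: algebra_simps)
  have "continuous_on (({a..b} \<times> {a..b}) \<times> cbox 0 1)
      (\<lambda>(p, t). G (fst p) (snd p + t * (fst p - snd p)) (snd p))"
    using seg unfolding case_prod_beta
    by (intro continuous_on_compose2[OF G[unfolded case_prod_beta],
            where f = "\<lambda>q. (fst (fst q), snd (fst q) + snd q * (fst (fst q) - snd (fst q)), snd (fst q))",
            simplified] continuous_intros) auto
  then have "continuous_on ({a..b} \<times> {a..b})
      (\<lambda>p. integral (cbox 0 1) (\<lambda>t. G (fst p) (snd p + t * (fst p - snd p)) (snd p)))"
    by (rule integral_continuous_on_param)
  then have cont: "continuous_on ({a..b} \<times> {a..b})
      (\<lambda>p. (fst p - snd p) *\<^sub>R integral {0..1} (\<lambda>t. G (fst p) (snd p + t * (fst p - snd p)) (snd p)))"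
    by (intro continuous_intros) simp
  have rescale: "(LBINT z=y..x. G x z y) = (x - y) *\<^sub>R integral {0..1} (\<lambda>t. G x (y + t * (x - y)) y)"
    if "x \<in> {a..b}" "y \<in> {a..b}" for x y
  proof (rule interval_integral_rescale[where f = "\<lambda>z. G x z y", OF _ that])
    show "continuous_on {a..b} (\<lambda>z. G x z y)"
      using that
      by (intro continuous_on_compose2[OF G, where f = "\<lambda>z. (x, z, y)", simplified]) (auto intro!: continuous_intros)
  qed
  show ?thesis
    by (rule continuous_on_eq[OF cont]) (auto simp: rescale)
qed

text \<open>
  One step of the usual Volterra estimate: every further integration raises the power of \<open>\<bar>x - y\<bar>\<close>
  by one and divides by the new exponent, which produces the factorials.
\<close>

lemma norm_interval_integral_power_bound:
  fixes a b x y :: real and f :: "real \<Rightarrow> complex"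
  assumes f: "continuous_on {a..b} f" and xy: "x \<in> {a..b}" "y \<in> {a..b}"
    and bound: "\<And>z. z \<in> closed_segment y x \<Longrightarrow> norm (f z) \<le> C * (\<bar>z - y\<bar> ^ m / fact m)"
  shows "norm (LBINT z=y..x. f z) \<le> C * (\<bar>x - y\<bar> ^ Suc m / fact (Suc m))"
proof -
  have seg: "y + t * (x - y) \<in> closed_segment y x" if "t \<in> {0..1}" for t
    using that by (auto simp: in_segment algebra_simps intro!: exI[of _ t])
  have sub: "closed_segment y x \<subseteq> {a..b}"
    using xy by (simp add: closed_segment_subset)
  have cf: "continuous_on {0..1} (\<lambda>t. f (y + t * (x - y)))"
    by (rule continuous_on_compose2[OF f]) (use seg sub in \<open>auto intro!: continuous_intros\<close>)
  have hi: "((\<lambda>t. C * \<bar>x - y\<bar> ^ m / fact m * t ^ m) has_integral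
      C * \<bar>x - y\<bar> ^ m / fact m * (1 / Suc m)) {0..1}"
  proof (rule has_integral_mult_right)
    have "((\<lambda>t::real. t ^ m) has_integral 1 ^ Suc m / Suc m - 0 ^ Suc m / Suc m) {0..1}"
      by (rule fundamental_theorem_of_calculus)
        (auto intro!: derivative_eq_intros simp flip: has_real_derivative_iff_has_vector_derivative
          simp del: power_Suc of_nat_Suc)
    then show "((\<lambda>t::real. t ^ m) has_integral 1 / Suc m) {0..1}" by simp
  qed
  have "norm (integral {0..1} (\<lambda>t. f (y + t * (x - y))))
      \<le> integral {0..1} (\<lambda>t. C * \<bar>x - y\<bar> ^ m / fact m * t ^ m)"
  proof (rule integral_norm_bound_integral)
    show "norm (f (y + t * (x - y))) \<le> C * \<bar>x - y\<bar> ^ m / fact m * t ^ m" if "t \<in> {0..1}" for t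
      using bound[OF seg[OF that]] that by (simp add: abs_mult power_mult_distrib mult_ac)
  qed (use cf hi in \<open>auto intro: integrable_continuous_real\<close>)
  also have "\<dots> = C * \<bar>x - y\<bar> ^ m / fact m * (1 / Suc m)"
    by (rule integral_unique[OF hi])
  finally have "\<bar>x - y\<bar> * norm (integral {0..1} (\<lambda>t. f (y + t * (x - y))))
      \<le> \<bar>x - y\<bar> * (C * \<bar>x - y\<bar> ^ m / fact m * (1 / Suc m))"
    by (rule mult_left_mono) simp
  then show ?thesis
    unfolding interval_integral_rescale[OF f xy] norm_scaleR real_norm_def
    by (simp add: divide_inverse mult_ac)
qed

text \<open>
  Both sides integrate \<open>F\<close> over the compact triangle \<open>a \<le> y \<le> z \<le> x\<close>, on which Fubini's theorem
  applies to the continuous function \<open>F\<close>.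
\<close>

lemma interval_integral_swap_triangle:
  fixes a b x :: real and F :: "real \<Rightarrow> real \<Rightarrow> complex"
  assumes F: "continuous_on ({a..b} \<times> {a..b}) (\<lambda>(z, y). F z y)" and x: "x \<in> {a..b}"
  shows "(LBINT z=a..x. (LBINT y=a..z. F z y)) = (LBINT y=a..x. (LBINT z=y..x. F z y))"
proof -
  define T where "T = {p::real \<times> real. a \<le> snd p \<and> snd p \<le> fst p \<and> fst p \<le> x}"
  have "closed T"
    unfolding T_def by (intro closed_Collect_conj closed_Collect_le continuous_intros)
  moreover have "T \<subseteq> {a..x} \<times> {a..x}" by (auto simp: T_def)
  ultimately have "compact T"
    by (metis bounded_subset compact_Icc compact_Times compact_eq_bounded_closed)
  moreover have "continuous_on T (\<lambda>(z, y). F z y)"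
    by (rule continuous_on_subset[OF F]) (use x in \<open>auto simp: T_def\<close>)
  ultimately have int: "integrable (lborel \<Otimes>\<^sub>M lborel)
      (\<lambda>(z, y). indicator T (z, y) *\<^sub>R F z y)"
    using borel_integrable_compact[of T "\<lambda>(z, y). F z y"] by (simp add: lborel_prod case_prod_unfold)
  have "(LBINT z=a..x. (LBINT y=a..z. F z y)) = (LBINT z:{a..x}. LBINT y=a..z. F z y)"
    using x by (simp add: interval_integral_Icc)
  also have "\<dots> = (LBINT z. (LBINT y. indicator T (z, y) *\<^sub>R F z y))"
    unfolding set_lebesgue_integral_def
  proof (rule Bochner_Integration.integral_cong[OF refl])
    fix z
    show "indicator {a..x} z *\<^sub>R (LBINT y=a..z. F z y) = (LBINT y. indicator T (z, y) *\<^sub>R F z y)"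
    proof (cases "z \<in> {a..x}")
      case True
      then show ?thesis
        by (auto simp: interval_integral_Icc set_lebesgue_integral_def T_def indicator_def
          intro!: Bochner_Integration.integral_cong)
    next
      case False
      then have outside: "indicator T (z, y) *\<^sub>R F z y = 0" for y
        by (auto simp: T_def indicator_def)
      show ?thesis using False unfolding outside by simp
    qed
  qed
  also have "\<dots> = (LBINT y. (LBINT z. indicator T (z, y) *\<^sub>R F z y))"
    by (rule lborel_pair.Fubini_integral[OF int, symmetric])
  also have "\<dots> = (LBINT y:{a..x}. (LBINT z=y..x. F z y))"
    unfolding set_lebesgue_integral_def
  proof (rule Bochner_Integration.integral_cong[OF refl])
    fix y
    show "(LBINT z. indicator T (z, y) *\<^sub>R F z y) = indicator {a..x} y *\<^sub>R (LBINT z=y..x. F z y)"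
    proof (cases "y \<in> {a..x}")
      case True
      then show ?thesis
        by (auto simp: interval_integral_Icc set_lebesgue_integral_def T_def indicator_def
          intro!: Bochner_Integration.integral_cong)
    next
      case False
      then have outside: "indicator T (z, y) *\<^sub>R F z y = 0" for z
        by (auto simp: T_def indicator_def)
      show ?thesis using False unfolding outside by simp
    qed
  qed
  also have "\<dots> = (LBINT y=a..x. (LBINT z=y..x. F z y))"
    using x by (simp add: interval_integral_Icc)
  finally show ?thesis .
qed

text \<open>
  The Weierstrass test makes the series converge uniformly, which permits integration term by term.
\<close>

lemma interval_integral_sums:
  fixes a b x y :: real and f :: "nat \<Rightarrow> real \<Rightarrow> complex"
  assumes f: "\<And>j. continuous_on {a..b} (f j)" and xy: "x \<in> {a..b}" "y \<in> {a..b}"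
    and bound: "\<And>j z. z \<in> {a..b} \<Longrightarrow> norm (f j z) \<le> B j" and B: "summable B"
  shows "(\<lambda>j. LBINT z=y..x. f j z) sums (LBINT z=y..x. (\<Sum>j. f j z))"
proof -
  define g where "g t = y + t * (x - y)" for t
  have g: "g t \<in> {a..b}" if "t \<in> {0..1}" for t
    using convexD_alt[of "{a..b}" y x t] xy that by (auto simp: g_def algebra_simps)
  have cg: "continuous_on {0..1} (\<lambda>t. f j (g t))" for j
    by (rule continuous_on_compose2[OF f]) (use g in \<open>auto simp: g_def intro!: continuous_intros\<close>)
  have lim: "uniform_limit {a..b} (\<lambda>n z. \<Sum>j<n. f j z) (\<lambda>z. \<Sum>j. f j z) sequentially"
    by (rule Weierstrass_m_test[OF bound B])
  have csum: "continuous_on {a..b} (\<lambda>z. \<Sum>j. f j z)"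
    by (rule uniform_limit_theorem[OF _ lim]) (auto intro!: always_eventually continuous_intros f)
  have "uniform_limit {0..1} (\<lambda>n t. \<Sum>j<n. f j (g t)) (\<lambda>t. \<Sum>j. f j (g t)) sequentially"
    by (rule uniform_limit_compose'[OF lim]) (use g in auto)
  then obtain I J where I: "\<And>n. ((\<lambda>t. \<Sum>j<n. f j (g t)) has_integral I n) {0..1}"
    and J: "((\<lambda>t. \<Sum>j. f j (g t)) has_integral J) {0..1}" and IJ: "I \<longlonglongrightarrow> J"
    by (rule uniform_limit_integral) (auto intro!: continuous_intros cg)
  have "I = (\<lambda>n. \<Sum>j<n. integral {0..1} (\<lambda>t. f j (g t)))"
    using integral_unique[OF I] by (auto simp: integral_sum integrable_continuous_real cg)
  with IJ have "(\<lambda>j. integral {0..1} (\<lambda>t. f j (g t))) sums J"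
    by (simp add: sums_def)
  then have "(\<lambda>j. (x - y) *\<^sub>R integral {0..1} (\<lambda>t. f j (g t))) sums ((x - y) *\<^sub>R J)"
    by (rule sums_scaleR_right)
  then show ?thesis
    using integral_unique[OF J] 
    by (simp add: interval_integral_rescale[OF f xy] interval_integral_rescale[OF csum xy] g_def)
qed

lemma continuous_on_sections:
  assumes "continuous_on ({a..b} \<times> {a..b}) (\<lambda>(x, y). F x y)"
  shows "x \<in> {a..b} \<Longrightarrow> continuous_on {a..b} (\<lambda>y. F x y)"
    and "y \<in> {a..b} \<Longrightarrow> continuous_on {a..b} (\<lambda>x. F x y)"
    and "continuous_on ({a..b} \<times> {a..b} \<times> {a..b}) (\<lambda>(x, z, y). F x z)"
    and "continuous_on ({a..b} \<times> {a..b} \<times> {a..b}) (\<lambda>(x, z, y). F z y)"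
proof -
  have compose: "continuous_on S (\<lambda>s. F (f s) (g s))"
    if "continuous_on S f" "continuous_on S g" "f ` S \<subseteq> {a..b}" "g ` S \<subseteq> {a..b}"
    for S :: "'c::topological_space set" and f g
    using continuous_on_compose2[OF assms continuous_on_Pair[OF that(1,2)]] that(3,4) by auto
  show "x \<in> {a..b} \<Longrightarrow> continuous_on {a..b} (\<lambda>y. F x y)"
    and "y \<in> {a..b} \<Longrightarrow> continuous_on {a..b} (\<lambda>x. F x y)"
    and "continuous_on ({a..b} \<times> {a..b} \<times> {a..b}) (\<lambda>(x, z, y). F x z)"
    and "continuous_on ({a..b} \<times> {a..b} \<times> {a..b}) (\<lambda>(x, z, y). F z y)"
    unfolding case_prod_beta by (rule compose; force intro!: continuous_intros)+
qed

lemma continuous_on_kernel_composition: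
  fixes a b :: real and A B :: "real \<Rightarrow> real \<Rightarrow> complex"
  assumes A: "continuous_on ({a..b} \<times> {a..b}) (\<lambda>(x, y). A x y)"
    and B: "continuous_on ({a..b} \<times> {a..b}) (\<lambda>(x, y). B x y)"
  shows "continuous_on ({a..b} \<times> {a..b}) (\<lambda>(x, y). LBINT z=y..x. A x z * B z y)"
  using continuous_on_mult[OF continuous_on_sections(3)[OF A] continuous_on_sections(4)[OF B]]
  by (intro continuous_on_interval_integral_param) (simp add: case_prod_beta)

lemma continuous_on_kernel_apply:
  fixes a b :: real and A :: "real \<Rightarrow> real \<Rightarrow> complex"
  assumes "a \<le> b" and A: "continuous_on ({a..b} \<times> {a..b}) (\<lambda>(x, y). A x y)"
    and g: "continuous_on {a..b} g"
  shows "continuous_on {a..b} (\<lambda>x. LBINT z=a..x. A x z * g z)"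
proof -
  have "continuous_on ({a..b} \<times> {a..b}) (\<lambda>(x, y). g x)"
    unfolding case_prod_beta by (intro continuous_on_compose2[OF g] continuous_intros) auto
  from continuous_on_sections(2)[OF continuous_on_kernel_composition[OF A this], of a] \<open>a \<le> b\<close>
  show ?thesis by simp
qed

text \<open>
  Applying the kernel \<open>A\<close> after the operator \<open>g \<mapsto> g + B g\<close> amounts to applying the kernel \<open>A + A B\<close>.
  With \<open>A = k\<close> and \<open>B\<close> its resolvent this solves the Volterra equation with kernel \<open>k\<close>; with
  \<open>A x z = (x - z)^(n - 1) / (n - 1)!\<close> it produces the kernel \<open>T\<close>.
\<close>

lemma interval_integral_kernel_compose:
  fixes a b x :: real and A B :: "real \<Rightarrow> real \<Rightarrow> complex"
  assumes A: "continuous_on ({a..b} \<times> {a..b}) (\<lambda>(x, y). A x y)"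
    and B: "continuous_on ({a..b} \<times> {a..b}) (\<lambda>(x, y). B x y)"
    and g: "continuous_on {a..b} g" and x: "x \<in> {a..b}"
  shows "(LBINT z=a..x. A x z * (g z + (LBINT y=a..z. B z y * g y)))
    = (LBINT y=a..x. (A x y + (LBINT z=y..x. A x z * B z y)) * g y)"
proof -
  have a: "a \<in> {a..b}" and "a \<le> b" using x by auto
  note integrable = interval_integrable_continuous_unordered[OF _ x a]
  have cA: "continuous_on {a..b} (\<lambda>z. A x z)"
    by (rule continuous_on_sections(1)[OF A x])
  have cg2: "continuous_on ({a..b} \<times> {a..b}) (\<lambda>(z, y). g y)"
    unfolding case_prod_beta by (intro continuous_on_compose2[OF g] continuous_intros) auto
  have cA2: "continuous_on ({a..b} \<times> {a..b}) (\<lambda>(z, y). A x z)"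
    unfolding case_prod_beta by (intro continuous_on_compose2[OF cA] continuous_intros) auto
  have "(LBINT z=a..x. A x z * (LBINT y=a..z. B z y * g y))
      = (LBINT z=a..x. (LBINT y=a..z. A x z * (B z y * g y)))"
    by simp
  also have "\<dots> = (LBINT y=a..x. (LBINT z=y..x. A x z * (B z y * g y)))"
    using continuous_on_mult[OF cA2 continuous_on_mult[OF B cg2]] x
    by (intro interval_integral_swap_triangle[where b = b]) (simp_all add: case_prod_beta)
  also have "\<dots> = (LBINT y=a..x. (LBINT z=y..x. A x z * B z y) * g y)"
    by (simp flip: mult.assoc)
  finally have swap: "(LBINT z=a..x. A x z * (LBINT y=a..z. B z y * g y))
      = (LBINT y=a..x. (LBINT z=y..x. A x z * B z y) * g y)" .
  have cAB: "continuous_on {a..b} (\<lambda>y. LBINT z=y..x. A x z * B z y)"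
    by (rule continuous_on_sections(1)[OF continuous_on_kernel_composition[OF A B] x])
  show ?thesis
    unfolding distrib_left distrib_right
    by (subst (1 2) interval_lebesgue_integral_add(2))
      (auto intro!: integrable continuous_intros cA g cAB swap
        continuous_on_kernel_apply[OF \<open>a \<le> b\<close> B g])
qed

section \<open>The resolvent of a continuous Volterra kernel\<close>

primrec iterated_kernel :: "(real \<Rightarrow> real \<Rightarrow> complex) \<Rightarrow> nat \<Rightarrow> real \<Rightarrow> real \<Rightarrow> complex" where
  "iterated_kernel k 0 x y = k x y"
| "iterated_kernel k (Suc m) x y = (LBINT z=y..x. k x z * iterated_kernel k m z y)"

text \<open>
  The Neumann series of the Volterra operator with kernel \<open>k\<close>, on the level of kernels.
\<close>

definition resolvent_kernel :: "(real \<Rightarrow> real \<Rightarrow> complex) \<Rightarrow> real \<Rightarrow> real \<Rightarrow> complex" where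
  "resolvent_kernel k x y = (\<Sum>j. iterated_kernel k j x y)"

locale volterra_kernel =
  fixes a b :: real and k :: "real \<Rightarrow> real \<Rightarrow> complex"
  assumes continuous_kernel: "continuous_on ({a..b} \<times> {a..b}) (\<lambda>(x, y). k x y)"
begin

lemma continuous_on_iterated_kernel:
  "continuous_on ({a..b} \<times> {a..b}) (\<lambda>(x, y). iterated_kernel k m x y)"
proof (induction m)
  case 0
  then show ?case using continuous_kernel by simp
next
  case (Suc m)
  then show ?case
    using continuous_on_kernel_composition[OF continuous_kernel Suc] by simp
qed

lemma kernel_bounded:
  obtains M where "M \<ge> 0" "\<And>x y. x \<in> {a..b} \<Longrightarrow> y \<in> {a..b} \<Longrightarrow> norm (k x y) \<le> M"
proof -
  have "compact ((\<lambda>(x, y). k x y) ` ({a..b} \<times> {a..b}))"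
    by (intro compact_continuous_image continuous_kernel compact_Times compact_Icc)
  then obtain M where "M > 0" "\<And>v. v \<in> (\<lambda>(x, y). k x y) ` ({a..b} \<times> {a..b}) \<Longrightarrow> norm v \<le> M"
    by (meson bounded_pos compact_imp_bounded)
  then show thesis by (intro that[of M]) force+
qed

text \<open>
  The factorial in the denominator makes the Neumann series converge on all of \<open>{a..b}\<close>, without any
  smallness condition on \<open>k\<close> or on the length of the interval.
\<close>

lemma norm_iterated_kernel_le:
  assumes M: "M \<ge> 0" "\<And>x y. x \<in> {a..b} \<Longrightarrow> y \<in> {a..b} \<Longrightarrow> norm (k x y) \<le> M"
    and xy: "x \<in> {a..b}" "y \<in> {a..b}"
  shows "norm (iterated_kernel k m x y) \<le> M ^ Suc m * (\<bar>x - y\<bar> ^ m / fact m)"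
  using xy(1)
proof (induction m arbitrary: x)
  case 0
  then show ?case using M(2) xy(2) by simp
next
  case (Suc m)
  have "norm (LBINT z=y..x. k x z * iterated_kernel k m z y)
      \<le> (M * M ^ Suc m) * (\<bar>x - y\<bar> ^ Suc m / fact (Suc m))"
  proof (rule norm_interval_integral_power_bound[OF _ Suc.prems xy(2)])
    show "continuous_on {a..b} (\<lambda>z. k x z * iterated_kernel k m z y)"
      by (intro continuous_on_mult continuous_on_sections(1)[OF continuous_kernel]
          continuous_on_sections(2)[OF continuous_on_iterated_kernel] Suc.prems xy)
    fix z assume "z \<in> closed_segment y x"
    then have "z \<in> {a..b}"
      using Suc.prems xy(2) closed_segment_subset[of y "{a..b}" x] by auto
    then show "norm (k x z * iterated_kernel k m z y) \<le> M * M ^ Suc m * (\<bar>z - y\<bar> ^ m / fact m)"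
      using mult_mono[OF M(2)[OF Suc.prems] Suc.IH] M(1) by (simp add: norm_mult mult.assoc)
  qed
  then show ?case by simp
qed

text \<open>
  A majorant that does not depend on \<open>x\<close> and \<open>y\<close>, as the Weierstrass test demands; its terms are those
  of an exponential series.
\<close>

lemma iterated_kernel_majorant:
  obtains B where "summable B"
    "\<And>m x y. x \<in> {a..b} \<Longrightarrow> y \<in> {a..b} \<Longrightarrow> norm (iterated_kernel k m x y) \<le> B m"
proof -
  obtain M where M: "M \<ge> 0" "\<And>x y. x \<in> {a..b} \<Longrightarrow> y \<in> {a..b} \<Longrightarrow> norm (k x y) \<le> M"
    by (rule kernel_bounded) blast
  show thesis
  proof (rule that[of "\<lambda>m. M * (inverse (fact m) * (M * (b - a)) ^ m)"])
    show "summable (\<lambda>m. M * (inverse (fact m) * (M * (b - a)) ^ m))"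
      by (intro summable_mult summable_exp)
    fix m x y assume xy: "x \<in> {a..b}" "y \<in> {a..b}"
    then have "\<bar>x - y\<bar> ^ m \<le> (b - a) ^ m"
      by (intro power_mono) auto
    then have "M ^ Suc m * (\<bar>x - y\<bar> ^ m / fact m) \<le> M ^ Suc m * ((b - a) ^ m / fact m)"
      using M(1) by (intro mult_left_mono divide_right_mono) auto
    also have "\<dots> = M * (inverse (fact m) * (M * (b - a)) ^ m)"
      by (simp add: power_mult_distrib divide_inverse mult_ac)
    finally show "norm (iterated_kernel k m x y) \<le> M * (inverse (fact m) * (M * (b - a)) ^ m)"
      using norm_iterated_kernel_le[OF M xy, of m] by simp
  qed
qed

lemma summable_iterated_kernel:
  assumes "x \<in> {a..b}" "y \<in> {a..b}"
  shows "summable (\<lambda>m. iterated_kernel k m x y)"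
proof -
  obtain B where "summable B"
    "\<And>m x y. x \<in> {a..b} \<Longrightarrow> y \<in> {a..b} \<Longrightarrow> norm (iterated_kernel k m x y) \<le> B m"
    by (rule iterated_kernel_majorant) blast
  then show ?thesis using assms by (blast intro: summable_comparison_test')
qed

lemma continuous_on_resolvent_kernel:
  "continuous_on ({a..b} \<times> {a..b}) (\<lambda>(x, y). resolvent_kernel k x y)"
proof -
  obtain B where B: "summable B"
    "\<And>m x y. x \<in> {a..b} \<Longrightarrow> y \<in> {a..b} \<Longrightarrow> norm (iterated_kernel k m x y) \<le> B m"
    by (rule iterated_kernel_majorant) blast
  have "uniform_limit ({a..b} \<times> {a..b}) (\<lambda>n p. \<Sum>m<n. case p of (x, y) \<Rightarrow> iterated_kernel k m x y)
      (\<lambda>p. \<Sum>m. case p of (x, y) \<Rightarrow> iterated_kernel k m x y) sequentially"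
    by (rule Weierstrass_m_test[OF _ B(1)]) (auto intro: B(2))
  then have "continuous_on ({a..b} \<times> {a..b}) (\<lambda>p. \<Sum>m. case p of (x, y) \<Rightarrow> iterated_kernel k m x y)"
    by (rule uniform_limit_theorem[rotated])
      (auto intro!: always_eventually continuous_on_sum continuous_on_iterated_kernel)
  then show ?thesis by (simp add: resolvent_kernel_def case_prod_beta)
qed

text \<open>
  Splitting off the first term of the Neumann series leaves the series of \<open>k\<close> composed with the
  iterated kernels, and the composition may be taken out of the sum.
\<close>

lemma resolvent_equation:
  assumes xy: "x \<in> {a..b}" "y \<in> {a..b}"
  shows "resolvent_kernel k x y = k x y + (LBINT z=y..x. k x z * resolvent_kernel k z y)"
proof -
  obtain B where B: "summable B"
    "\<And>m x y. x \<in> {a..b} \<Longrightarrow> y \<in> {a..b} \<Longrightarrow> norm (iterated_kernel k m x y) \<le> B m"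
    by (rule iterated_kernel_majorant) blast
  obtain M where M: "M \<ge> 0" "\<And>x y. x \<in> {a..b} \<Longrightarrow> y \<in> {a..b} \<Longrightarrow> norm (k x y) \<le> M"
    by (rule kernel_bounded) blast
  have "(\<lambda>m. LBINT z=y..x. k x z * iterated_kernel k m z y)
      sums (LBINT z=y..x. (\<Sum>m. k x z * iterated_kernel k m z y))"
  proof (rule interval_integral_sums[OF _ xy])
    show "continuous_on {a..b} (\<lambda>z. k x z * iterated_kernel k m z y)" for m
      by (intro continuous_on_mult continuous_on_sections(1)[OF continuous_kernel]
          continuous_on_sections(2)[OF continuous_on_iterated_kernel] xy)
    show "norm (k x z * iterated_kernel k m z y) \<le> M * B m" if "z \<in> {a..b}" for m z
      unfolding norm_mult using that M xy by (intro mult_mono M(2) B(2)) auto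
    show "summable (\<lambda>m. M * B m)" by (intro summable_mult B)
  qed
  then have "(\<Sum>m. iterated_kernel k (Suc m) x y)
      = (LBINT z=y..x. (\<Sum>m. k x z * iterated_kernel k m z y))"
    by (simp add: sums_iff)
  also have "\<dots> = (LBINT z=y..x. k x z * resolvent_kernel k z y)"
  proof (rule interval_integral_cong_Icc[OF xy])
    fix z assume "z \<in> {a..b}"
    then show "(\<Sum>m. k x z * iterated_kernel k m z y) = k x z * resolvent_kernel k z y"
      unfolding resolvent_kernel_def by (intro suminf_mult summable_iterated_kernel xy)
  qed
  finally show ?thesis
    using suminf_split_head[OF summable_iterated_kernel[OF xy]]
    by (simp add: resolvent_kernel_def algebra_simps)
qed

text \<open>
  Inserting the equation into itself \<open>j\<close> times bounds \<open>d x\<close> by a constant times the \<open>j\<close>-th term of an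
  exponential series, which tends to \<open>0\<close>.
\<close>

lemma volterra_homogeneous_zero:
  assumes d: "continuous_on {a..b} d"
    and eq: "\<And>x. x \<in> {a..b} \<Longrightarrow> d x = (LBINT z=a..x. k x z * d z)" and x: "x \<in> {a..b}"
  shows "d x = 0"
proof -
  obtain M where M: "M \<ge> 0" "\<And>x y. x \<in> {a..b} \<Longrightarrow> y \<in> {a..b} \<Longrightarrow> norm (k x y) \<le> M"
    by (rule kernel_bounded) blast
  obtain C where C: "\<And>x. x \<in> {a..b} \<Longrightarrow> norm (d x) \<le> C"
    using compact_imp_bounded[OF compact_continuous_image[OF d compact_Icc]]
    by (force simp: bounded_iff)
  have a: "a \<in> {a..b}" using x by auto
  have bound: "norm (d x) \<le> C * M ^ j * (\<bar>x - a\<bar> ^ j / fact j)" if "x \<in> {a..b}" for j x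
    using that
  proof (induction j arbitrary: x)
    case 0
    then show ?case using C by simp
  next
    case (Suc j)
    have "norm (LBINT z=a..x. k x z * d z) \<le> (M * (C * M ^ j)) * (\<bar>x - a\<bar> ^ Suc j / fact (Suc j))"
    proof (rule norm_interval_integral_power_bound[OF _ Suc.prems a])
      show "continuous_on {a..b} (\<lambda>z. k x z * d z)"
        by (intro continuous_on_mult continuous_on_sections(1)[OF continuous_kernel] Suc.prems d)
      fix z assume "z \<in> closed_segment a x"
      then have "z \<in> {a..b}"
        using Suc.prems by (auto simp: closed_segment_eq_real_ivl)
      then show "norm (k x z * d z) \<le> M * (C * M ^ j) * (\<bar>z - a\<bar> ^ j / fact j)"
        using mult_mono[OF M(2)[OF Suc.prems] Suc.IH] M(1) by (simp add: norm_mult mult.assoc)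
    qed
    then show ?case using eq[OF Suc.prems] by (simp add: mult_ac)
  qed
  have "(\<lambda>j. C * (inverse (fact j) * (M * \<bar>x - a\<bar>) ^ j)) \<longlonglongrightarrow> C * 0"
    by (intro tendsto_intros summable_LIMSEQ_zero summable_exp)
  then have "(\<lambda>j. C * M ^ j * (\<bar>x - a\<bar> ^ j / fact j)) \<longlonglongrightarrow> 0"
    by (simp add: power_mult_distrib divide_inverse mult_ac)
  then have "norm (d x) \<le> 0"
    by (rule LIMSEQ_le_const) (use bound[OF x] in blast)
  then show ?thesis by simp
qed

text \<open>
  The function on the right solves the integral equation because of the resolvent equation, and it is
  the only continuous solution because the difference of two of them solves the homogeneous equation.
\<close>

theorem volterra_equation_iff:
  assumes w: "continuous_on {a..b} w" and g: "continuous_on {a..b} g"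
  shows "(\<forall>x\<in>{a..b}. w x = g x + (LBINT z=a..x. k x z * w z)) \<longleftrightarrow>
    (\<forall>x\<in>{a..b}. w x = g x + (LBINT z=a..x. resolvent_kernel k x z * g z))"
proof (cases "a \<le> b")
  case True
  define v where "v x = g x + (LBINT z=a..x. resolvent_kernel k x z * g z)" for x
  have cv: "continuous_on {a..b} v"
    unfolding v_def
    by (intro continuous_intros g continuous_on_kernel_apply continuous_on_resolvent_kernel True)
  have v: "v x = g x + (LBINT z=a..x. k x z * v z)" if x: "x \<in> {a..b}" for x
  proof -
    have "(LBINT z=a..x. k x z * v z)
        = (LBINT y=a..x. (k x y + (LBINT z=y..x. k x z * resolvent_kernel k z y)) * g y)"
      unfolding v_def
      by (rule interval_integral_kernel_compose[OF continuous_kernel continuous_on_resolvent_kernel g x])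
    also have "\<dots> = (LBINT y=a..x. resolvent_kernel k x y * g y)"
    proof (rule interval_integral_cong_Icc[OF x])
      show "a \<in> {a..b}" using True by simp
      fix y assume "y \<in> {a..b}"
      then show "(k x y + (LBINT z=y..x. k x z * resolvent_kernel k z y)) * g y
          = resolvent_kernel k x y * g y"
        using resolvent_equation[OF x] by simp
    qed
    finally show ?thesis by (simp add: v_def)
  qed
  have cong: "(LBINT z=a..x. k x z * f z) = (LBINT z=a..x. k x z * f' z)"
    if "x \<in> {a..b}" "\<forall>z\<in>{a..b}. f z = f' z" for x f f'
    using that by (intro interval_integral_cong_Icc) auto
  show ?thesis
    unfolding v_def[symmetric]
  proof
    assume w_eq: "\<forall>x\<in>{a..b}. w x = g x + (LBINT z=a..x. k x z * w z)"
    have "w x - v x = 0" if "x \<in> {a..b}" for x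
    proof (rule volterra_homogeneous_zero[OF _ _ that])
      show "continuous_on {a..b} (\<lambda>x. w x - v x)" by (intro continuous_intros w cv)
      fix x assume x: "x \<in> {a..b}"
      then have a: "a \<in> {a..b}" by auto
      note integrable = interval_integrable_continuous_unordered[OF _ x a]
      have "(LBINT z=a..x. k x z * (w z - v z)) = (LBINT z=a..x. k x z * w z) - (LBINT z=a..x. k x z * v z)"
        unfolding right_diff_distrib
        by (rule interval_lebesgue_integral_diff(2))
          (intro integrable continuous_on_mult continuous_on_sections(1)[OF continuous_kernel] x w cv)+
      then show "w x - v x = (LBINT z=a..x. k x z * (w z - v z))"
        using bspec[OF w_eq x] v[OF x] by (simp only: add_diff_cancel_left)
    qed
    then show "\<forall>x\<in>{a..b}. w x = v x" by simp
  next
    assume w_v: "\<forall>x\<in>{a..b}. w x = v x"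
    show "\<forall>x\<in>{a..b}. w x = g x + (LBINT z=a..x. k x z * w z)"
    proof
      fix x assume x: "x \<in> {a..b}"
      show "w x = g x + (LBINT z=a..x. k x z * w z)"
        unfolding bspec[OF w_v x] cong[OF x w_v] by (rule v[OF x])
    qed
  qed
qed auto

end

section \<open>Reduction of the differential equation to a Volterra equation\<close>

lemma interval_integral_sum_finite:
  fixes f :: "'i \<Rightarrow> real \<Rightarrow> complex" and x y :: real
  assumes "\<And>i. i \<in> I \<Longrightarrow> interval_lebesgue_integrable lborel y x (f i)"
  shows "(LBINT z=y..x. (\<Sum>i\<in>I. f i z)) = (\<Sum>i\<in>I. LBINT z=y..x. f i z)"
  using assms
  unfolding interval_lebesgue_integral_def interval_lebesgue_integrable_def
    set_lebesgue_integral_def set_integrable_def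
  by (auto simp: scaleR_sum_right Bochner_Integration.integral_sum sum_negf split: if_splits)

text \<open>
  Functions \<open>Df 0, \<dots>, Df n\<close>, each the derivative of its predecessor, are all recovered from their
  initial values and the last one, by Taylor's formula for \<open>Df k\<close> with integral remainder. It is this
  formula that lets \<open>Df n\<close> serve as the only unknown.
\<close>

lemma Taylor_interval_integral:
  fixes Df :: "nat \<Rightarrow> real \<Rightarrow> complex"
  assumes tower: "\<And>m t. m < n \<Longrightarrow> t \<in> {a..b} \<Longrightarrow>
      (Df m has_vector_derivative Df (Suc m) t) (at t within {a..b})"
    and cont: "continuous_on {a..b} (Df n)" and k: "k < n" and x: "x \<in> {a..b}"
  shows "Df k x = (\<Sum>i<n - k. Df (k + i) a * of_real (x - a) ^ i / fact i)
    + (LBINT z=a..x. of_real (x - z) ^ (n - k - 1) / fact (n - k - 1) * Df n z)"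
proof -
  have "Df k x = (\<Sum>i<n - k. ((x - a) ^ i / fact i) *\<^sub>R Df (k + i) a)
      + integral {a..x} (\<lambda>z. ((x - z) ^ (n - k - 1) / fact (n - k - 1)) *\<^sub>R Df (k + (n - k)) z)"
  proof (rule Taylor_integral)
    show "0 < n - k" "a \<le> x" "Df (k + 0) = Df k" using k x by auto
    fix m t assume "m < n - k" "a \<le> t" "t \<le> x"
    then show "(Df (k + m) has_vector_derivative Df (k + Suc m) t) (at t within {a..x})"
      using tower[of "k + m" t] x
      by (auto intro: has_vector_derivative_within_subset[where S = "{a..b}"])
  qed
  also have "integral {a..x} (\<lambda>z. ((x - z) ^ (n - k - 1) / fact (n - k - 1)) *\<^sub>R Df (k + (n - k)) z)
      = integral {a..x} (\<lambda>z. of_real (x - z) ^ (n - k - 1) / fact (n - k - 1) * Df n z)"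
    using k by (simp add: scaleR_conv_of_real)
  also have "\<dots> = (LBINT z=a..x. of_real (x - z) ^ (n - k - 1) / fact (n - k - 1) * Df n z)"
    using x by (intro interval_integral_eq_integral[symmetric] borel_integrable_atLeastAtMost'
        continuous_intros continuous_on_subset[OF cont]) auto
  finally show ?thesis
    by (simp add: scaleR_conv_of_real mult_ac)
qed

text \<open>
  The accumulator is constant with respect to the integration variables further inside, so that it can
  be moved outwards through all the integrals.
\<close>

lemma nested_int_eq_iterated_kernel:
  "nested_int n P y m p x = p * iterated_kernel (h_ker n P) m x y"
  by (induction m arbitrary: p x) (simp_all add: mult.assoc)

lemma continuous_on_h_ker:
  assumes "\<And>k. k < n \<Longrightarrow> continuous_on {a..b} (P k)"
  shows "continuous_on ({a..b} \<times> {a..b}) (\<lambda>(x, y). h_ker n P x y)"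
  unfolding h_ker_def case_prod_beta
  by (intro continuous_intros continuous_on_compose2[OF assms]) auto

lemma continuous_on_S_fun:
  assumes "\<And>k. k < n \<Longrightarrow> continuous_on {a..b} (P k)"
  shows "continuous_on {a..b} (S_fun n P a c)"
  unfolding S_fun_def by (intro continuous_intros assms) auto

lemma R_ker_eq_resolvent_kernel:
  assumes "\<And>k. k < n \<Longrightarrow> continuous_on {a..b} (P k)" and xy: "x \<in> {a..b}" "y \<in> {a..b}"
  shows "R_ker n P x y = resolvent_kernel (h_ker n P) x y"
proof -
  interpret volterra_kernel a b "h_ker n P"
    by standard (rule continuous_on_h_ker[OF assms(1)])
  show ?thesis
    using suminf_split_head[OF summable_iterated_kernel[OF xy]]
    by (simp add: R_ker_def R_term_def resolvent_kernel_def nested_int_eq_iterated_kernel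
        del: iterated_kernel.simps(2))
qed

text \<open>
  Taylor's formula turns the lower order terms of the differential operator into an integral operator
  acting on \<open>Df n\<close>. The Taylor polynomials contribute the inhomogeneity \<open>S\<close>, after summation over
  the triangle \<open>k + i < n\<close> along its diagonals, and the remainders contribute the kernel \<open>h\<close>. The
  differential equation thus becomes a Volterra equation for \<open>Df n\<close>.
\<close>

lemma lower_order_terms_eq:
  fixes Df :: "nat \<Rightarrow> real \<Rightarrow> complex"
  assumes tower: "\<And>m t. m < n \<Longrightarrow> t \<in> {a..b} \<Longrightarrow>
      (Df m has_vector_derivative Df (Suc m) t) (at t within {a..b})"
    and cont: "continuous_on {a..b} (Df n)"
    and init: "\<And>i. i < n \<Longrightarrow> Df i a = c i" and x: "x \<in> {a..b}"
  shows "(\<Sum>k<n. P k x * Df k x)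
    = - (S_fun n P a c x + (LBINT z=a..x. h_ker n P x z * Df n z))"
proof -
  have a: "a \<in> {a..b}" using x by auto
  let ?p = "\<lambda>i. of_real (x - a) ^ i / fact i :: complex"
  let ?K = "\<lambda>k z. of_real (x - z) ^ (n - k - 1) / fact (n - k - 1) :: complex"
  have "(\<Sum>k<n. P k x * Df k x)
      = (\<Sum>k<n. \<Sum>i<n - k. P k x * (c (k + i) * ?p i))
        + (\<Sum>k<n. P k x * (LBINT z=a..x. ?K k z * Df n z))"
    unfolding sum.distrib[symmetric]
  proof (rule sum.cong[OF refl])
    fix k assume "k \<in> {..<n}"
    then have "Df k x = (\<Sum>i<n - k. Df (k + i) a * of_real (x - a) ^ i / fact i)
        + (LBINT z=a..x. ?K k z * Df n z)"
      by (intro Taylor_interval_integral[OF tower cont _ x]) auto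
    also have "(\<Sum>i<n - k. Df (k + i) a * of_real (x - a) ^ i / fact i) = (\<Sum>i<n - k. c (k + i) * ?p i)"
      by (rule sum.cong) (auto simp: init)
    finally show "P k x * Df k x = (\<Sum>i<n - k. P k x * (c (k + i) * ?p i))
        + P k x * (LBINT z=a..x. ?K k z * Df n z)"
      by (simp only: distrib_left sum_distrib_left)
  qed
  also have "(\<Sum>k<n. \<Sum>i<n - k. P k x * (c (k + i) * ?p i))
      = (\<Sum>(k, i)\<in>{(k, i). k + i < n}. P k x * (c (k + i) * ?p i))"
    by (subst sum.Sigma) (auto intro!: sum.cong)
  also have "\<dots> = (\<Sum>i<n. \<Sum>k\<le>i. P k x * (c (k + (i - k)) * ?p (i - k)))"
    by (rule sum.triangle_reindex)
  also have "\<dots> = - S_fun n P a c x"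
    unfolding S_fun_def by (auto intro!: sum.cong simp: mult_ac)
  also have "(\<Sum>k<n. P k x * (LBINT z=a..x. ?K k z * Df n z))
      = (\<Sum>k<n. LBINT z=a..x. P k x * (?K k z * Df n z))"
    by simp
  also have "\<dots> = (LBINT z=a..x. (\<Sum>k<n. P k x * (?K k z * Df n z)))"
    by (intro interval_integral_sum_finite[symmetric] interval_integrable_continuous_unordered[OF _ x a]
        continuous_intros cont) auto
  also have "\<dots> = - (LBINT z=a..x. h_ker n P x z * Df n z)"
    unfolding h_ker_def
    by (simp add: sum_distrib_right mult.assoc interval_lebesgue_integral_uminus)
  finally show ?thesis by simp
qed

lemma deriv_on_Suc:
  "deriv_on a b (Suc i) u x = vector_derivative (deriv_on a b i u) (at x within {a..b})"
  by (simp add: deriv_on_def)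

text \<open>
  Functions related by successive differentiation are identified with the iterated derivatives of
  the first one; \<open>a < b\<close> makes one-sided derivatives unique at the endpoints too.
\<close>

lemma deriv_on_tower:
  assumes "a < b"
    and tower: "\<And>m t. m < n \<Longrightarrow> t \<in> {a..b} \<Longrightarrow>
      (Df m has_vector_derivative Df (Suc m) t) (at t within {a..b})"
    and u: "\<And>x. x \<in> {a..b} \<Longrightarrow> u x = Df 0 x"
    and "m \<le> n" "x \<in> {a..b}"
  shows "deriv_on a b m u x = Df m x"
  using assms(4,5)
proof (induction m arbitrary: x)
  case 0
  then show ?case by (simp add: deriv_on_def u)
next
  case (Suc m)
  have "(deriv_on a b m u has_vector_derivative Df (Suc m) x) (at x within {a..b})"
    by (rule has_vector_derivative_transform[OF Suc.prems(2) _ tower]) (use Suc in auto)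
  then show ?case
    unfolding deriv_on_Suc by (rule vector_derivative_within_closed_interval[OF \<open>a < b\<close> Suc.prems(2)])
qed

text \<open>
  Integrating \<open>w\<close> repeatedly from \<open>a\<close>, with the prescribed integration constants, yields a function
  whose derivatives are known by construction; no convolution with a power of \<open>x - z\<close> has to be
  differentiated. Continuity of \<open>Df 0\<close> is what the induction needs for the next integration.
\<close>

lemma derivative_tower_exists:
  fixes w :: "real \<Rightarrow> complex"
  assumes w: "continuous_on {a..b} w"
  shows "\<exists>Df. (\<forall>m<n. \<forall>t\<in>{a..b}. (Df m has_vector_derivative Df (Suc m) t) (at t within {a..b}))
    \<and> (\<forall>m<n. Df m a = c m) \<and> Df n = w \<and> continuous_on {a..b} (Df 0)"
proof (induction n arbitrary: c)
  case 0
  then show ?case using w by (auto intro!: exI[of _ "\<lambda>_. w"])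
next
  case (Suc n)
  obtain E where E: "\<And>m t. m < n \<Longrightarrow> t \<in> {a..b} \<Longrightarrow>
        (E m has_vector_derivative E (Suc m) t) (at t within {a..b})"
      "\<And>m. m < n \<Longrightarrow> E m a = c (Suc m)" "E n = w" "continuous_on {a..b} (E 0)"
    using Suc[of "\<lambda>m. c (Suc m)"] by blast
  define F where "F x = c 0 + integral {a..x} (E 0)" for x
  have F: "(F has_vector_derivative E 0 t) (at t within {a..b})" if "t \<in> {a..b}" for t
    unfolding F_def
    using integral_has_vector_derivative[OF E(4) that] by (auto intro!: derivative_eq_intros)
  have "continuous_on {a..b} F"
    by (rule continuous_on_vector_derivative[OF F])
  moreover have "F a = c 0" by (simp add: F_def)
  ultimately show ?case
    using E F by (intro exI[of _ "case_nat F E"]) (auto simp: less_Suc_eq_0_disj)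
qed

text \<open>
  If \<open>w\<close> is the resolvent solution for \<open>g\<close>, then composing the remainder kernel
  \<open>(x - z)^(n - 1) / (n - 1)!\<close> with the resolvent turns its action on \<open>w\<close> into that of \<open>T\<close> on \<open>g\<close>.
\<close>

lemma interval_integral_T_ker:
  assumes P: "\<And>k. k < n \<Longrightarrow> continuous_on {a..b} (P k)" and x: "x \<in> {a..b}"
    and g: "continuous_on {a..b} g"
    and w: "\<And>z. z \<in> {a..b} \<Longrightarrow> w z = g z + (LBINT y=a..z. resolvent_kernel (h_ker n P) z y * g y)"
  shows "(LBINT z=a..x. of_real (x - z) ^ (n - 1) / fact (n - 1) * w z)
    = (LBINT z=a..x. T_ker n P x z * g z)"
proof -
  interpret volterra_kernel a b "h_ker n P"
    by standard (rule continuous_on_h_ker[OF P])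
  let ?K = "\<lambda>x z. of_real (x - z) ^ (n - 1) / fact (n - 1) :: complex"
  have a: "a \<in> {a..b}" using x by auto
  have K: "continuous_on ({a..b} \<times> {a..b}) (\<lambda>(x, z). ?K x z)"
    unfolding case_prod_beta by (intro continuous_intros) auto
  have "(LBINT z=a..x. ?K x z * w z)
      = (LBINT z=a..x. ?K x z * (g z + (LBINT y=a..z. resolvent_kernel (h_ker n P) z y * g y)))"
    by (rule interval_integral_cong_Icc[OF x a]) (simp add: w)
  also have "\<dots> = (LBINT y=a..x.
      (?K x y + (LBINT z=y..x. ?K x z * resolvent_kernel (h_ker n P) z y)) * g y)"
    by (rule interval_integral_kernel_compose[OF K continuous_on_resolvent_kernel g x])
  also have "\<dots> = (LBINT y=a..x. T_ker n P x y * g y)"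
  proof (rule interval_integral_cong_Icc[OF x a])
    fix y assume y: "y \<in> {a..b}"
    have "(LBINT z=y..x. ?K x z * resolvent_kernel (h_ker n P) z y) = (LBINT z=y..x. ?K x z * R_ker n P z y)"
      by (rule interval_integral_cong_Icc[OF x y]) (simp add: R_ker_eq_resolvent_kernel[OF P _ y])
    then show "(?K x y + (LBINT z=y..x. ?K x z * resolvent_kernel (h_ker n P) z y)) * g y
        = T_ker n P x y * g y"
      by (simp add: T_ker_def)
  qed
  finally show ?thesis .
qed

text \<open>
  Both directions rest on the same two facts about functions \<open>Df 0, \<dots>, Df n\<close> that are linked by
  differentiation and have the right initial values: the differential equation holds exactly if
  \<open>Df n\<close> is the resolvent solution \<open>w\<close> of the Volterra equation, and in that case \<open>Df 0\<close> has the
  stated form. For a given solution \<open>u\<close> these functions are the derivatives of \<open>u\<close>; for the converse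
  they are the repeated integrals of \<open>w\<close>.
\<close>

lemma solves_ivp_iff_representation:
  assumes "n \<ge> 1" "a < b" and P: "\<And>k. k < n \<Longrightarrow> continuous_on {a..b} (P k)"
  shows "solves_ivp n a b P c u \<longleftrightarrow>
    (\<forall>x\<in>{a..b}. u x = D_fun n a c x + (LBINT z=a..x. T_ker n P x z * S_fun n P a c z))"
proof -
  interpret volterra_kernel a b "h_ker n P"
    by standard (rule continuous_on_h_ker[OF P])
  note S = continuous_on_S_fun[OF P, where c = c]
  define w where "w x = S_fun n P a c x
    + (LBINT z=a..x. resolvent_kernel (h_ker n P) x z * S_fun n P a c z)" for x
  have cont_w: "continuous_on {a..b} w"
    unfolding w_def using \<open>a < b\<close>
    by (intro continuous_intros S continuous_on_kernel_apply continuous_on_resolvent_kernel) auto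
  have tower_solution: "(\<forall>x\<in>{a..b}. Df n x + (\<Sum>k<n. P k x * Df k x) = 0) \<longleftrightarrow>
      (\<forall>x\<in>{a..b}. Df n x = w x)"
    and tower_formula: "(\<forall>x\<in>{a..b}. Df n x = w x) \<Longrightarrow> x \<in> {a..b} \<Longrightarrow>
      Df 0 x = D_fun n a c x + (LBINT z=a..x. T_ker n P x z * S_fun n P a c z)"
    if tower: "\<And>m t. m < n \<Longrightarrow> t \<in> {a..b} \<Longrightarrow>
        (Df m has_vector_derivative Df (Suc m) t) (at t within {a..b})"
      and init: "\<And>i. i < n \<Longrightarrow> Df i a = c i" and cont: "continuous_on {a..b} (Df n)" for Df x
  proof -
    have "(\<forall>x\<in>{a..b}. Df n x + (\<Sum>k<n. P k x * Df k x) = 0) \<longleftrightarrow>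
        (\<forall>x\<in>{a..b}. Df n x = S_fun n P a c x + (LBINT z=a..x. h_ker n P x z * Df n z))"
      by (intro ball_cong refl)
        (simp only: lower_order_terms_eq[OF tower cont init] add.right_neutral add_eq_0_iff2 minus_minus)
    also have "\<dots> \<longleftrightarrow> (\<forall>x\<in>{a..b}. Df n x = w x)"
      unfolding w_def by (rule volterra_equation_iff[OF cont S])
    finally show "(\<forall>x\<in>{a..b}. Df n x + (\<Sum>k<n. P k x * Df k x) = 0) \<longleftrightarrow>
      (\<forall>x\<in>{a..b}. Df n x = w x)" .
    assume Df_w: "\<forall>x\<in>{a..b}. Df n x = w x" and x: "x \<in> {a..b}"
    have "Df 0 x = D_fun n a c x + (LBINT z=a..x. of_real (x - z) ^ (n - 1) / fact (n - 1) * Df n z)"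
      using Taylor_interval_integral[OF tower cont _ x, of 0] \<open>n \<ge> 1\<close>
      by (simp add: D_fun_def init)
    also have "(LBINT z=a..x. of_real (x - z) ^ (n - 1) / fact (n - 1) * Df n z)
        = (LBINT z=a..x. T_ker n P x z * S_fun n P a c z)"
      using Df_w by (intro interval_integral_T_ker[OF P x S]) (auto simp: w_def)
    finally show "Df 0 x = D_fun n a c x + (LBINT z=a..x. T_ker n P x z * S_fun n P a c z)" .
  qed
  show ?thesis
  proof
    assume u: "solves_ivp n a b P c u"
    let ?Df = "\<lambda>i. deriv_on a b i u"
    have tower: "(?Df m has_vector_derivative ?Df (Suc m) t) (at t within {a..b})"
      if "m < n" "t \<in> {a..b}" for m t
      using u that
      by (auto simp: solves_ivp_def differentiable_on_def deriv_on_Suc simp flip: vector_derivative_works)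
    have init: "?Df i a = c i" if "i < n" for i
      using u that by (simp add: solves_ivp_def)
    have ode: "\<forall>x\<in>{a..b}. ?Df n x + (\<Sum>k<n. P k x * ?Df k x) = 0"
      using u by (simp add: solves_ivp_def)
    \<comment> \<open>Continuity of the highest derivative is not part of the notion of a solution; the equation forces it.\<close>
    have "continuous_on {a..b} (?Df k)" if "k < n" for k
      by (rule continuous_on_vector_derivative[OF tower[OF that]])
    then have "continuous_on {a..b} (\<lambda>x. - (\<Sum>k<n. P k x * ?Df k x))"
      by (intro continuous_intros P) auto
    then have cont: "continuous_on {a..b} (?Df n)"
      by (rule continuous_on_eq) (use ode in \<open>auto simp: add_eq_0_iff2\<close>)
    have "\<forall>x\<in>{a..b}. ?Df n x = w x"
      using tower_solution[OF tower init cont] ode by blast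
    from tower_formula[OF tower init cont this]
    show "\<forall>x\<in>{a..b}. u x = D_fun n a c x + (LBINT z=a..x. T_ker n P x z * S_fun n P a c z)"
      by (simp add: deriv_on_def)
  next
    assume u: "\<forall>x\<in>{a..b}. u x = D_fun n a c x + (LBINT z=a..x. T_ker n P x z * S_fun n P a c z)"
    obtain Df where tower: "\<And>m t. m < n \<Longrightarrow> t \<in> {a..b} \<Longrightarrow>
        (Df m has_vector_derivative Df (Suc m) t) (at t within {a..b})"
      and init: "\<And>i. i < n \<Longrightarrow> Df i a = c i" and Df_n: "Df n = w"
      using derivative_tower_exists[OF cont_w, where n = n and c = c] by blast
    have cont: "continuous_on {a..b} (Df n)" using cont_w by (simp add: Df_n)
    have u_Df: "u x = Df 0 x" if "x \<in> {a..b}" for x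
      using tower_formula[OF tower init cont _ that] u that Df_n by simp
    have deriv: "deriv_on a b m u x = Df m x" if "m \<le> n" "x \<in> {a..b}" for m x
      by (rule deriv_on_tower[OF \<open>a < b\<close> tower u_Df that])
    have "(deriv_on a b m u has_vector_derivative Df (Suc m) t) (at t within {a..b})"
      if "m < n" "t \<in> {a..b}" for m t
      by (rule has_vector_derivative_transform[OF that(2) _ tower[OF that]]) (use deriv that in auto)
    then have "deriv_on a b i u differentiable_on {a..b}" if "i < n" for i
      using that unfolding differentiable_on_def by (blast intro: differentiableI_vector)
    moreover have "deriv_on a b n u x + (\<Sum>k<n. P k x * deriv_on a b k u x) = 0" if "x \<in> {a..b}" for x
      using tower_solution[OF tower init cont] Df_n that by (simp add: deriv)
    moreover have "deriv_on a b i u a = c i" if "i < n" for i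
      using deriv[of i a] init[OF that] that \<open>a < b\<close> by simp
    ultimately show "solves_ivp n a b P c u" by (simp add: solves_ivp_def)
  qed
qed

theorem theorem3:
  fixes n :: nat and a b :: real
    and P :: "nat \<Rightarrow> real \<Rightarrow> complex" and c :: "nat \<Rightarrow> complex"
  assumes "n \<ge> 1" and "a < b"
    and "\<And>k. k < n \<Longrightarrow> continuous_on {a..b} (P k)"
  shows
    "(\<forall>y\<in>{a..b}. \<forall>x\<in>{a..b}.
        (\<forall>m p. interval_lebesgue_integrable lborel y x
                 (\<lambda>z. nested_int n P y m (p * h_ker n P x z) z)) \<and>
        summable (\<lambda>j. R_term n P (j + 2) x y) \<and>
        interval_lebesgue_integrable lborel y x
          (\<lambda>z. of_real (x - z) ^ (n - 1) / fact (n - 1) * R_ker n P z y)) \<and>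
     (\<forall>x\<in>{a..b}. interval_lebesgue_integrable lborel a x
        (\<lambda>z. T_ker n P x z * S_fun n P a c z)) \<and>
     (\<forall>u. solves_ivp n a b P c u \<longleftrightarrow>
        (\<forall>x\<in>{a..b}. u x = D_fun n a c x
           + (LBINT z=a..x. T_ker n P x z * S_fun n P a c z)))"
proof (intro conjI ballI allI)
  interpret volterra_kernel a b "h_ker n P"
    by standard (rule continuous_on_h_ker[OF assms(3)])
  let ?K = "\<lambda>x z. of_real (x - z) ^ (n - 1) / fact (n - 1) :: complex"
  have a: "a \<in> {a..b}" using \<open>a < b\<close> by simp
  have R: "continuous_on ({a..b} \<times> {a..b}) (\<lambda>(x, y). R_ker n P x y)"
    by (rule continuous_on_eq[OF continuous_on_resolvent_kernel])
      (auto simp: R_ker_eq_resolvent_kernel[OF assms(3)])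
  have K: "continuous_on ({a..b} \<times> {a..b}) (\<lambda>(x, z). ?K x z)"
    unfolding case_prod_beta by (intro continuous_intros) auto
  show "solves_ivp n a b P c u \<longleftrightarrow>
    (\<forall>x\<in>{a..b}. u x = D_fun n a c x + (LBINT z=a..x. T_ker n P x z * S_fun n P a c z))" for u
    by (rule solves_ivp_iff_representation[OF assms])
  fix x assume x: "x \<in> {a..b}"
  have T: "continuous_on {a..b} (\<lambda>z. T_ker n P x z)"
    unfolding T_ker_def
    by (intro continuous_on_add continuous_on_sections(1)[OF K x]
        continuous_on_sections(1)[OF continuous_on_kernel_composition[OF K R] x])
  show "interval_lebesgue_integrable lborel a x (\<lambda>z. T_ker n P x z * S_fun n P a c z)"
    by (intro interval_integrable_continuous_unordered[OF _ x a] continuous_on_mult T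
        continuous_on_S_fun assms(3))
  fix y assume y: "y \<in> {a..b}"
  show "interval_lebesgue_integrable lborel y x (\<lambda>z. nested_int n P y m (p * h_ker n P x z) z)" for m p
    unfolding nested_int_eq_iterated_kernel
    by (intro interval_integrable_continuous_unordered[OF _ x y] continuous_on_mult continuous_on_const
        continuous_on_sections(1)[OF continuous_kernel x]
        continuous_on_sections(2)[OF continuous_on_iterated_kernel y])
  show "summable (\<lambda>j. R_term n P (j + 2) x y)"
    using summable_iff_shift[of "\<lambda>j. iterated_kernel (h_ker n P) j x y" 1] summable_iterated_kernel[OF x y]
    by (simp add: R_term_def nested_int_eq_iterated_kernel del: iterated_kernel.simps(2))
  show "interval_lebesgue_integrable lborel y x (\<lambda>z. ?K x z * R_ker n P z y)"
    by (intro interval_integrable_continuous_unordered[OF _ x y] continuous_on_mult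
        continuous_on_sections(1)[OF K x] continuous_on_sections(2)[OF R y])
qed

end
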